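(* Let $Q=p^r$, where $p$ is an odd prime and $r\ge 1$, and let $N_Q$ be the number of triples $\gamma-1,\gamma,\gamma+1$ of consecutive non-square elements of $\mathbb{F}_Q$. If $Q\le 9$, then $N_Q=0$. If $Q>9$, then $$N_Q\ \ge\ \frac18\bigl(Q-2\sqrt{Q}-3\bigr),$$ with equality if and only if $p\equiv 3\pmod 4$ and $r=2s$ with $s$ odd. Hence $N_Q$ is positive if and only if $Q>9$.
   Context: $\mathbb{F}_Q$ is the finite field with $Q$ elements. An element of $\mathbb{F}_Q$ is a square if it equals $\beta^2$ for some $\beta\in\mathbb{F}_Q$ (so $0$ is a square), and a non-square otherwise. $N_Q$ counts the elements $\gamma\in\mathbb{F}_Q$ such that all three of $\gamma-1,\gamma,\gamma+1$ are non-squares. *)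

theory Defs
  imports
    Complex_Main
    "HOL-Library.Cardinality"
    "HOL-Computational_Algebra.Nth_Powers"
    "HOL-Number_Theory.Cong"
begin

text \<open>
  The finite field with \<open>Q\<close> elements is a type \<open>'a\<close> of class \<open>finite_field\<close> with
  \<open>CARD('a) = Q\<close>. In \<open>is_square\<close> the witness ranges over all of \<open>'a\<close>, so \<open>0\<close> is a square.
  A triple is counted through its middle element.
\<close>

definition nonsquare_triple_count :: "'a::finite_field itself \<Rightarrow> nat" where
  "nonsquare_triple_count _ =
     card {\<gamma>::'a. \<not> is_square (\<gamma> - 1) \<and> \<not> is_square \<gamma> \<and> \<not> is_square (\<gamma> + 1)}"

end

theory Submission
  imports Defs "HOL-Number_Theory.Residues" "HOL-Computational_Algebra.Polynomial"
begin

text \<open>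
  Let \<open>\<chi>\<close> be the quadratic character of the field with \<open>Q\<close> elements. Writing the indicator of a
  non-square as \<open>(1 - \<chi>) / 2\<close> expresses \<open>8 N\<close> as \<open>Q - 3 - S\<close>, up to a correction of at most \<open>4\<close> that
  occurs only for \<open>Q \<equiv> 3\<close> modulo \<open>4\<close>; here \<open>S = \<Sum>x. \<chi>(x\<^sup>3 - x)\<close>
  (\<open>nonsquare_triple_count_eq\<close>). The theorem is therefore the Hasse bound \<open>S \<le> 2 \<surd>Q\<close> for the curve
  \<open>y\<^sup>2 = x\<^sup>3 - x\<close>, with a description of equality.

  If \<open>Q \<equiv> 3\<close> modulo \<open>4\<close>, then \<open>\<chi>(-1) = -1\<close> and \<open>S = 0\<close>; the bound is then strict because
  \<open>2 \<surd>Q > 4\<close> for \<open>Q > 9\<close>. If \<open>Q \<equiv> 1\<close> modulo \<open>4\<close>, Jacobsthal's elementary argument applies: the sum at \<open>1\<close>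
  is compared with the sum \<open>T = \<Sum>x. \<chi>(x\<^sup>3 - g x)\<close> for a non-square \<open>g\<close>. Computing the second moment
  of these sums over all parameters gives \<open>S\<^sup>2 + T\<^sup>2 = 4 Q\<close> (\<open>jacobsthal_two_squares\<close>), and the
  bound follows.

  Equality needs arithmetic. The symmetries \<open>x \<mapsto> -x\<close> and \<open>x \<mapsto> 1 / x\<close> of the summands
  determine \<open>S\<close> modulo \<open>8\<close> (\<open>jacobsthal_sum_cong_8\<close>). If \<open>p \<equiv> 3\<close> modulo \<open>4\<close> and \<open>Q = p\<^sup>2\<^sup>s\<close>, the
  only representations of \<open>Q\<close> as a sum of two squares are trivial, so \<open>S = \<plusminus>2 p\<^sup>s\<close>, and the congruence
  selects \<open>S = -2 (-p)\<^sup>s\<close> (\<open>jacobsthal_sum_prime_3_mod_4\<close>): equality holds exactly for odd \<open>s\<close>. If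
  \<open>p \<equiv> 1\<close> modulo \<open>4\<close>, then \<open>S\<close> is modulo \<open>p\<close> a central binomial coefficient, up to sign, that \<open>p\<close>
  does not divide, while equality would make \<open>p\<close> divide \<open>S\<close> (\<open>jacobsthal_sum_not_extremal\<close>).

  Positivity is immediate from \<open>Q - 2 \<surd>Q - 3 = (\<surd>Q - 3) (\<surd>Q + 1)\<close>.
\<close>

section \<open>The quadratic character\<close>

definition quad_char :: "'a::finite_field \<Rightarrow> int" where
  "quad_char x = (if x = 0 then 0 else if is_square x then 1 else - 1)"

lemma quad_char_0 [simp]: "quad_char 0 = 0"
  by (simp add: quad_char_def)

lemma quad_char_values: "quad_char x \<in> {- 1, 0, 1}"
  by (simp add: quad_char_def)

lemma quad_char_eq_0_iff [simp]: "quad_char x = 0 \<longleftrightarrow> x = 0"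
  by (simp add: quad_char_def)

lemma quad_char_1 [simp]: "quad_char 1 = 1"
  by (simp add: quad_char_def)

lemma not_square_iff: "\<not> is_square x \<longleftrightarrow> quad_char x = - 1"
  by (auto simp: quad_char_def)

lemma quad_char_power2: "quad_char x ^ 2 = (if x = 0 then 0 else 1)"
  by (simp add: quad_char_def)

lemma card_finite_field_gt_1: "CARD('a::finite_field) > 1"
proof -
  have "card {0, 1::'a} \<le> CARD('a)"
    by (intro card_mono) auto
  then show ?thesis by simp
qed

lemma one_neq_minus_one:
  assumes "odd CARD('a::finite_field)"
  shows "(1::'a) \<noteq> - 1"
proof
  assume "(1::'a) = - 1"
  then have "of_nat 2 = (0::'a)"
    by (metis add.right_inverse of_nat_numeral one_add_one)
  then have "CHAR('a) dvd 2"
    by (simp only: of_nat_eq_0_iff_char_dvd)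
  moreover have "CHAR('a) \<noteq> 2"
    using CHAR_dvd_CARD[where 'a = 'a] assms by auto
  ultimately show False
    using CHAR_prime[where 'a = 'a] by (metis primes_dvd_imp_eq two_is_prime_nat)
qed

lemma power_card_minus_one:
  fixes x :: "'a::finite_field"
  assumes "x \<noteq> 0"
  shows "x ^ (CARD('a) - 1) = 1"
proof -
  have "x * x ^ (CARD('a) - 1) = x ^ CARD('a)"
    by (metis finite_UNIV_card_ge_0 finite power_minus_mult mult.commute)
  with assms show ?thesis
    by (simp add: finite_field_power_card_eq_same)
qed

lemma card_power_eq_one_le:
  fixes n :: nat
  assumes "n > 0"
  shows "card {x::'a::finite_field. x ^ n = 1} \<le> n"
proof -
  define f :: "'a poly" where "f = monom 1 n - 1"
  have "coeff f n = 1"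
    using assms by (simp add: f_def)
  then have "f \<noteq> 0"
    by auto
  then have "card {x. poly f x = 0} \<le> degree f"
    by (rule card_poly_roots_bound)
  also have "degree f \<le> n"
    unfolding f_def by (intro degree_diff_le degree_monom_le) simp
  also have "{x. poly f x = 0} = {x. x ^ n = 1}"
    by (simp add: f_def poly_monom)
  finally show ?thesis .
qed

text \<open>
  Squaring on \<open>'a - {0}\<close> is two-to-one, since the fibre of \<open>u\<^sup>2\<close> is \<open>{u, -u}\<close>.
\<close>

lemma card_nonzero_squares:
  assumes odd: "odd CARD('a::finite_field)"
  shows "2 * card {x::'a. x \<noteq> 0 \<and> is_square x} = CARD('a) - 1"
proof -
  let ?S = "{x::'a. x \<noteq> 0 \<and> is_square x}"
  have "card (UNIV - {0::'a}) = (\<Sum>y\<in>?S. card {x \<in> UNIV - {0}. x ^ 2 = y})"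
  proof -
    have "UNIV - {0::'a} = (\<Union>y\<in>?S. {x \<in> UNIV - {0}. x ^ 2 = y})"
      by (auto simp: is_nth_power_def)
    then show ?thesis
      by (subst card_UN_disjoint[symmetric]) auto
  qed
  also have "\<dots> = (\<Sum>y\<in>?S. 2)"
  proof (rule sum.cong)
    fix y :: 'a assume "y \<in> ?S"
    then obtain u where u: "y = u ^ 2" "u \<noteq> 0"
      by (auto simp: is_nth_power_def)
    have "{x \<in> UNIV - {0}. x ^ 2 = y} = {u, - u}"
      using u by (auto simp: power2_eq_iff)
    moreover have "u \<noteq> - u"
    proof
      assume "u = - u"
      then have "u * 1 = u * (- 1)" by simp
      then show False
        using u one_neq_minus_one[OF odd] by (metis mult_cancel_left)
    qed
    ultimately show "card {x \<in> UNIV - {0}. x ^ 2 = y} = 2"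
      by simp
  qed simp
  finally show ?thesis
    by (simp add: card_Diff_singleton)
qed

text \<open>
  The nonzero squares are roots of \<open>X\<^sup>n - 1\<close> for \<open>n = (Q - 1) / 2\<close>; there are \<open>n\<close> of them and at most
  \<open>n\<close> roots, so the two sets agree. Every other nonzero \<open>x\<close> satisfies \<open>(x\<^sup>n)\<^sup>2 = 1\<close> and hence
  \<open>x\<^sup>n = -1\<close>. The criterion turns multiplicativity of the character into that of the power map, and
  it is what allows character sums to be evaluated in characteristic \<open>p\<close>.
\<close>

lemma euler_criterion:
  fixes x :: "'a::finite_field"
  assumes odd: "odd CARD('a)"
  shows "of_int (quad_char x) = x ^ ((CARD('a) - 1) div 2)"
proof -
  define n where "n = (CARD('a) - 1) div 2"
  have q: "CARD('a) - 1 = 2 * n" "n > 0"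
    using odd card_finite_field_gt_1[where 'a = 'a] by (auto simp: n_def elim!: oddE)
  let ?S = "{x::'a. x \<noteq> 0 \<and> is_square x}" and ?R = "{x::'a. x ^ n = 1}"
  have sub: "?S \<subseteq> ?R"
    using power_card_minus_one[where 'a = 'a] q
    by (auto simp: is_nth_power_def power_mult [symmetric])
  have "card ?S = n"
    using card_nonzero_squares[OF odd] q by simp
  with card_power_eq_one_le[OF q(2), where 'a = 'a] sub have eq: "?S = ?R"
    by (intro card_seteq) auto
  show ?thesis
  proof (cases "x = 0")
    case True
    then show ?thesis using q by (simp add: n_def [symmetric])
  next
    case False
    have "(x ^ n) ^ 2 = 1"
      using power_card_minus_one[OF False] q by (simp add: power_mult [symmetric] mult.commute)
    then have "x ^ n = 1 \<or> x ^ n = - 1"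
      by (simp add: power2_eq_1_iff)
    moreover have "is_square x \<longleftrightarrow> x ^ n = 1"
      using eq False by auto
    ultimately show ?thesis
      unfolding n_def [symmetric] using False one_neq_minus_one[OF odd]
      by (auto simp: quad_char_def)
  qed
qed

lemma quad_char_mult:
  fixes x y :: "'a::finite_field"
  assumes odd: "odd CARD('a)"
  shows "quad_char (x * y) = quad_char x * quad_char y"
proof -
  have "of_int (quad_char (x * y)) = (of_int (quad_char x * quad_char y) :: 'a)"
    by (simp add: euler_criterion[OF odd] power_mult_distrib)
  moreover have "a = b" if "a \<in> {- 1, 0, 1}" "b \<in> {- 1, 0, 1}" "of_int a = (of_int b :: 'a)"
    for a b :: int
    using that one_neq_minus_one[OF odd] by auto
  moreover have "quad_char x * quad_char y \<in> {- 1, 0, 1}"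
    using quad_char_values[of x] quad_char_values[of y] by auto
  ultimately show ?thesis
    using quad_char_values by blast
qed

lemma quad_char_square:
  fixes x :: "'a::finite_field"
  assumes "x \<noteq> 0"
  shows "quad_char (x ^ 2) = 1"
  using assms by (simp add: quad_char_def)

lemma quad_char_square_mult:
  fixes u x :: "'a::finite_field"
  assumes "odd CARD('a)" and "u \<noteq> 0"
  shows "quad_char (u ^ 2 * x) = quad_char x"
  using assms by (simp add: quad_char_mult quad_char_square)

lemma quad_char_minus_one:
  assumes odd: "odd CARD('a::finite_field)"
  shows "quad_char (- 1 :: 'a) = (if CARD('a) mod 4 = 1 then 1 else - 1)"
proof -
  have e: "of_int (quad_char (- 1 :: 'a)) = (- 1 :: 'a) ^ ((CARD('a) - 1) div 2)"
    by (rule euler_criterion[OF odd])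
  have "even ((CARD('a) - 1) div 2) \<longleftrightarrow> CARD('a) mod 4 = 1"
    using odd by presburger
  with e one_neq_minus_one[OF odd] quad_char_values[of "- 1 :: 'a"] show ?thesis
    by (auto split: if_splits)
qed

lemma ex_nonsquare:
  assumes odd: "odd CARD('a::finite_field)"
  shows "\<exists>g::'a. g \<noteq> 0 \<and> quad_char g = - 1"
proof (rule ccontr)
  assume "\<not> ?thesis"
  then have *: "{x::'a. x \<noteq> 0 \<and> is_square x} = UNIV - {0}"
    by (auto simp: quad_char_def split: if_splits)
  show False
    using card_nonzero_squares[OF odd] card_finite_field_gt_1[where 'a = 'a]
    unfolding * by (simp add: card_Diff_singleton)
qed

lemma sum_quad_char:
  assumes odd: "odd CARD('a::finite_field)"
  shows "(\<Sum>x::'a\<in>UNIV. quad_char x) = 0"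
proof -
  obtain g :: 'a where g: "g \<noteq> 0" "quad_char g = - 1"
    using ex_nonsquare[OF odd] by blast
  have "(\<Sum>x::'a\<in>UNIV. quad_char x) = (\<Sum>x::'a\<in>UNIV. quad_char (g * x))"
    by (rule sum.reindex_bij_witness[of _ "\<lambda>x. g * x" "\<lambda>x. x / g"]) (use g in auto)
  also have "\<dots> = - (\<Sum>x::'a\<in>UNIV. quad_char x)"
    by (simp add: quad_char_mult[OF odd] g sum_negf)
  finally show ?thesis by simp
qed

text \<open>
  After moving one root to \<open>0\<close>, the term at \<open>t \<noteq> 0\<close> is \<open>\<chi>(t\<^sup>2 (1 + (a - b) / t)) = \<chi>(1 + (a - b) / t)\<close>.
  For \<open>a \<noteq> b\<close> the argument runs through everything except \<open>1\<close>, which leaves \<open>0 - \<chi>(1)\<close>.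
\<close>

lemma sum_quad_char_quadratic:
  fixes a b :: "'a::finite_field"
  assumes odd: "odd CARD('a)"
  shows "(\<Sum>x::'a\<in>UNIV. quad_char ((x - a) * (x - b))) = (if a = b then int CARD('a) - 1 else - 1)"
proof -
  have "(\<Sum>x\<in>UNIV. quad_char ((x - a) * (x - b)))
      = (\<Sum>t\<in>UNIV. quad_char (t * (t + (a - b))))"
    by (rule sum.reindex_bij_witness[of _ "\<lambda>t. t + a" "\<lambda>x. x - a"]) (auto simp: algebra_simps)
  also have "\<dots> = (\<Sum>t\<in>UNIV - {0}. quad_char (t * (t + (a - b))))"
    by (rule sum.mono_neutral_right) auto
  also have "\<dots> = (\<Sum>t\<in>UNIV - {0}. quad_char (1 + (a - b) / t))"
  proof (rule sum.cong)
    fix t :: 'a assume "t \<in> UNIV - {0}"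
    then have "t \<noteq> 0" by simp
    then have "t * (t + (a - b)) = t ^ 2 * (1 + (a - b) / t)"
      by (auto simp: field_simps power2_eq_square)
    then show "quad_char (t * (t + (a - b))) = quad_char (1 + (a - b) / t)"
      by (simp only: quad_char_square_mult[OF odd \<open>t \<noteq> 0\<close>])
  qed simp
  also have "\<dots> = (if a = b then int CARD('a) - 1 else - 1)"
  proof (cases "a = b")
    case True
    then show ?thesis
      by (simp add: card_Diff_singleton of_nat_diff Suc_leI)
  next
    case False
    have "(\<Sum>t\<in>UNIV - {0}. quad_char (1 + (a - b) / t)) = (\<Sum>u\<in>UNIV - {1::'a}. quad_char u)"
      by (rule sum.reindex_bij_witness[of _ "\<lambda>u. (a - b) / (u - 1)" "\<lambda>t. 1 + (a - b) / t"])
        (use False in auto)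
    also have "\<dots> = - 1"
      by (simp add: sum_diff1 sum_quad_char[OF odd])
    finally show ?thesis using False by simp
  qed
  finally show ?thesis .
qed

section \<open>Jacobsthal sums and their second moment\<close>

text \<open>
  Up to sign this is the trace of Frobenius of the curve \<open>y\<^sup>2 = x\<^sup>3 - c x\<close>.
\<close>

definition jacobsthal_sum :: "'a::finite_field \<Rightarrow> int" where
  "jacobsthal_sum c = (\<Sum>x\<in>UNIV. quad_char (x * (x ^ 2 - c)))"

text \<open>
  Substituting \<open>u x\<close> for \<open>x\<close> pulls out a factor \<open>u\<^sup>3\<close>. Consequently the square of a Jacobsthal sum
  depends only on the quadratic character of its parameter.
\<close>

lemma jacobsthal_sum_twist:
  fixes c u :: "'a::finite_field"
  assumes odd: "odd CARD('a)" and "u \<noteq> 0"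
  shows "jacobsthal_sum (c * u ^ 2) = quad_char u * jacobsthal_sum c"
proof -
  have "jacobsthal_sum (c * u ^ 2) = (\<Sum>x\<in>UNIV. quad_char ((u * x) * ((u * x) ^ 2 - c * u ^ 2)))"
    unfolding jacobsthal_sum_def
    by (rule sum.reindex_bij_witness[of _ "\<lambda>x. u * x" "\<lambda>x. x / u"]) (use assms in auto)
  also have "\<dots> = (\<Sum>x\<in>UNIV. quad_char u * quad_char (x * (x ^ 2 - c)))"
  proof (rule sum.cong)
    fix x :: 'a
    have "(u * x) * ((u * x) ^ 2 - c * u ^ 2) = u ^ 2 * (u * (x * (x ^ 2 - c)))"
      by (simp add: algebra_simps power2_eq_square)
    then show "quad_char ((u * x) * ((u * x) ^ 2 - c * u ^ 2)) = quad_char u * quad_char (x * (x ^ 2 - c))"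
      by (simp only: quad_char_square_mult[OF odd \<open>u \<noteq> 0\<close>] quad_char_mult[OF odd, of u])
  qed simp
  finally show ?thesis
    by (simp add: jacobsthal_sum_def sum_distrib_left)
qed

lemma jacobsthal_sum_0:
  assumes odd: "odd CARD('a::finite_field)"
  shows "jacobsthal_sum (0::'a) = 0"
proof -
  have "quad_char (x * (x ^ 2 - 0)) = quad_char x" for x :: 'a
    by (cases "x = 0") (auto simp: quad_char_mult[OF odd] quad_char_square)
  then show ?thesis
    by (simp only: jacobsthal_sum_def sum_quad_char[OF odd])
qed

lemma jacobsthal_sum_eq_0:
  fixes c :: "'a::finite_field"
  assumes odd: "odd CARD('a)" and "CARD('a) mod 4 \<noteq> 1"
  shows "jacobsthal_sum c = 0"
proof -
  have "jacobsthal_sum (c * (- 1) ^ 2) = - jacobsthal_sum c"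
    by (subst jacobsthal_sum_twist[OF odd]) (use assms in \<open>auto simp: quad_char_minus_one\<close>)
  then show ?thesis by simp
qed

text \<open>
  Expand the square and sum over \<open>c\<close> first: the inner sum is the character sum of the quadratic
  \<open>(c - x\<^sup>2)(c - y\<^sup>2)\<close>, which is large only when \<open>y = \<plusminus>x\<close>. As \<open>-1\<close> is a square, each such pair with
  \<open>x \<noteq> 0\<close> contributes \<open>\<chi>(x y) = 1\<close>.
\<close>

lemma sum_jacobsthal_sum_squares:
  assumes mod: "CARD('a::finite_field) mod 4 = 1"
  shows "(\<Sum>c::'a\<in>UNIV. jacobsthal_sum c ^ 2) = 2 * int CARD('a) * (int CARD('a) - 1)"
proof -
  have odd: "odd CARD('a)" using mod by presburger
  let ?q = "int CARD('a)"
  have "(\<Sum>c::'a\<in>UNIV. jacobsthal_sum c ^ 2)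
      = (\<Sum>c::'a\<in>UNIV. \<Sum>x\<in>UNIV. \<Sum>y\<in>UNIV.
          quad_char (x * y) * quad_char ((c - x ^ 2) * (c - y ^ 2)))"
  proof (rule sum.cong)
    fix c :: 'a
    have "quad_char (x * (x ^ 2 - c)) * quad_char (y * (y ^ 2 - c))
        = quad_char (x * y) * quad_char ((c - x ^ 2) * (c - y ^ 2))" for x y :: 'a
      by (subst (1 2) quad_char_mult[OF odd, symmetric]) (simp add: algebra_simps)
    then show "jacobsthal_sum c ^ 2 = (\<Sum>x\<in>UNIV. \<Sum>y\<in>UNIV.
        quad_char (x * y) * quad_char ((c - x ^ 2) * (c - y ^ 2)))"
      by (simp add: jacobsthal_sum_def power2_eq_square sum_product)
  qed simp
  also have "\<dots> = (\<Sum>x\<in>UNIV. \<Sum>y\<in>UNIV. \<Sum>c::'a\<in>UNIV.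
      quad_char (x * y) * quad_char ((c - x ^ 2) * (c - y ^ 2)))"
    by (subst sum.swap, rule sum.cong[OF refl], rule sum.swap)
  also have "\<dots> = (\<Sum>x::'a\<in>UNIV. \<Sum>y\<in>UNIV.
      ?q * (if x ^ 2 = y ^ 2 then quad_char (x * y) else 0) - quad_char x * quad_char y)"
  proof (intro sum.cong refl)
    fix x y :: 'a
    show "(\<Sum>c::'a\<in>UNIV. quad_char (x * y) * quad_char ((c - x ^ 2) * (c - y ^ 2)))
        = ?q * (if x ^ 2 = y ^ 2 then quad_char (x * y) else 0) - quad_char x * quad_char y"
      unfolding sum_distrib_left [symmetric] sum_quad_char_quadratic[OF odd]
      by (simp add: quad_char_mult[OF odd] algebra_simps)
  qed
  also have "\<dots> = ?q * (\<Sum>x::'a\<in>UNIV. \<Sum>y\<in>UNIV. if x ^ 2 = y ^ 2 then quad_char (x * y) else 0)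
      - (\<Sum>x::'a\<in>UNIV. quad_char x) * (\<Sum>y::'a\<in>UNIV. quad_char y)"
    by (simp only: sum_subtractf sum_distrib_left [of ?q] sum_product)
  also have "(\<Sum>x::'a\<in>UNIV. \<Sum>y\<in>UNIV. if x ^ 2 = y ^ 2 then quad_char (x * y) else 0)
      = (\<Sum>x::'a\<in>UNIV. if x = 0 then 0 else 2)"
  proof (rule sum.cong)
    fix x :: 'a
    have "(\<Sum>y\<in>UNIV. if x ^ 2 = y ^ 2 then quad_char (x * y) else 0)
        = (\<Sum>y\<in>{x, - x}. quad_char (x * y))"
      by (rule sum.mono_neutral_cong_right) (auto simp: power2_eq_iff)
    also have "\<dots> = (if x = 0 then 0 else 2)"
    proof (cases "x = 0")
      case False
      then have "x \<noteq> - x"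
        using one_neq_minus_one[OF odd]
        by (metis mult.right_neutral mult_cancel_left mult_minus_right)
      moreover have "quad_char (- x) = quad_char x"
        using quad_char_mult[OF odd, of "- 1" x] quad_char_minus_one[OF odd] mod by simp
      ultimately show ?thesis
        using False quad_char_power2[of x]
        by (simp add: quad_char_mult[OF odd] power2_eq_square del: mult_minus_right)
    qed auto
    finally show "(\<Sum>y\<in>UNIV. if x ^ 2 = y ^ 2 then quad_char (x * y) else 0)
        = (if x = 0 then 0 else 2)" .
  qed simp
  also have "(\<Sum>x::'a\<in>UNIV. if x = 0 then 0 else 2) = (\<Sum>x\<in>UNIV - {0::'a}. 2 :: int)"
    by (rule sum.mono_neutral_cong_right) auto
  also have "\<dots> = 2 * (?q - 1)"
    by (simp add: card_Diff_singleton of_nat_diff Suc_leI)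
  finally show ?thesis
    by (simp add: sum_quad_char[OF odd])
qed

lemma jacobsthal_sum_square_cong:
  fixes c d :: "'a::finite_field"
  assumes odd: "odd CARD('a)" and "quad_char c = quad_char d"
  shows "jacobsthal_sum c ^ 2 = jacobsthal_sum d ^ 2"
proof (cases "d = 0")
  case True
  then show ?thesis using assms(2) by simp
next
  case False
  have "quad_char (c / d) = 1"
  proof -
    have "quad_char (c / d) * quad_char d = quad_char d"
      using False assms by (simp add: quad_char_mult[OF odd, symmetric])
    then show ?thesis using False by simp
  qed
  then have *: "is_square (c / d)" "c / d \<noteq> 0"
    by (auto simp only: quad_char_def split: if_splits)
  then obtain u where u: "c / d = u ^ 2"
    by (meson is_nth_powerE)
  with *(2) have "u \<noteq> 0" by auto
  from u have c: "c = d * u ^ 2"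
    using False by (simp add: field_simps)
  show ?thesis
    unfolding c jacobsthal_sum_twist[OF odd \<open>u \<noteq> 0\<close>] power_mult_distrib
    using \<open>u \<noteq> 0\<close> by (simp add: quad_char_power2)
qed

text \<open>
  Of the \<open>Q - 1\<close> nonzero parameters half contribute the square of the sum at \<open>1\<close> to the second moment
  and half that of the sum at \<open>g\<close>. This identity contains the Hasse bound for \<open>y\<^sup>2 = x\<^sup>3 - x\<close>, and
  says that the bound is attained exactly when the sum at \<open>g\<close> vanishes.
\<close>

lemma jacobsthal_two_squares:
  fixes g :: "'a::finite_field"
  assumes mod: "CARD('a) mod 4 = 1" and g: "quad_char g = - 1"
  shows "jacobsthal_sum (1::'a) ^ 2 + jacobsthal_sum g ^ 2 = 4 * int CARD('a)"
proof -
  have odd: "odd CARD('a)" using mod by presburger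
  let ?S = "{x::'a. x \<noteq> 0 \<and> is_square x}" and ?T = "{x::'a. \<not> is_square x}"
  define n where "n = (CARD('a) - 1) div 2"
  have q: "CARD('a) = 2 * n + 1" "n > 0"
    using odd card_finite_field_gt_1[where 'a = 'a] by (auto simp: n_def elim!: oddE)
  have S: "card ?S = n"
    using card_nonzero_squares[OF odd] q by simp
  have U: "(UNIV :: 'a set) = insert 0 (?S \<union> ?T)"
    by auto
  have "card (UNIV :: 'a set) = Suc (card ?S + card ?T)"
    by (subst U, subst card_insert_disjoint) (auto intro!: card_Un_disjoint)
  with S q have T: "card ?T = n" by simp
  have "(\<Sum>c::'a\<in>UNIV. jacobsthal_sum c ^ 2)
      = jacobsthal_sum (0::'a) ^ 2 + ((\<Sum>c\<in>?S. jacobsthal_sum c ^ 2) + (\<Sum>c\<in>?T. jacobsthal_sum c ^ 2))"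
    by (subst U, subst sum.insert) (auto intro!: sum.union_disjoint)
  also have "(\<Sum>c\<in>?S. jacobsthal_sum c ^ 2) = (\<Sum>c\<in>?S. jacobsthal_sum (1::'a) ^ 2)"
    by (intro sum.cong refl jacobsthal_sum_square_cong[OF odd]) (auto simp: quad_char_def)
  also have "(\<Sum>c\<in>?T. jacobsthal_sum c ^ 2) = (\<Sum>c\<in>?T. jacobsthal_sum g ^ 2)"
    by (intro sum.cong refl jacobsthal_sum_square_cong[OF odd]) (auto simp: g not_square_iff)
  finally have "int n * (jacobsthal_sum (1::'a) ^ 2 + jacobsthal_sum g ^ 2)
      = 2 * int CARD('a) * (2 * int n)"
    unfolding sum_jacobsthal_sum_squares[OF mod]
    by (simp add: S T jacobsthal_sum_0[OF odd] q algebra_simps)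
  then have "int n * (jacobsthal_sum (1::'a) ^ 2 + jacobsthal_sum g ^ 2)
      = int n * (4 * int CARD('a))"
    by simp
  with q(2) show ?thesis by simp
qed

section \<open>The Jacobsthal sum modulo 8\<close>

text \<open>
  The value \<open>\<chi>(x\<^sup>3 - x)\<close> is invariant under \<open>x \<mapsto> -x\<close> and \<open>x \<mapsto> 1 / x\<close>, which generate a Klein four
  group. It acts freely away from \<open>0\<close>, \<open>\<plusminus>1\<close> and the square roots of \<open>-1\<close>; at the latter
  \<open>x\<^sup>3 - x = -2 x = (1 - x)\<^sup>2\<close> is a square. So all orbits in the set have four elements.
\<close>

lemma four_dvd_card_jacobsthal_minus:
  assumes mod: "CARD('a::finite_field) mod 4 = 1"
  shows "4 dvd card {x::'a. quad_char (x * (x ^ 2 - 1)) = - 1}"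
proof -
  have odd: "odd CARD('a)" using mod by presburger
  let ?f = "\<lambda>x::'a. x * (x ^ 2 - 1)"
  let ?M = "{x. quad_char (?f x) = - 1}"
  define orb where "orb x = {x, - x, 1 / x, - (1 / x)}" for x :: 'a
  have neg: "quad_char (- y) = quad_char y" for y :: 'a
    using quad_char_mult[OF odd, of "- 1" y] quad_char_minus_one[OF odd] mod by simp
  have nz: "x \<noteq> 0" if "x \<in> ?M" for x
    using that by auto
  have inv: "quad_char (?f (1 / x)) = quad_char (?f x)" if "x \<noteq> 0" for x
  proof -
    have "?f x = (x ^ 2) ^ 2 * - ?f (1 / x)"
      using that by (simp add: field_simps power2_eq_square)
    then have "quad_char (?f x) = quad_char ((x ^ 2) ^ 2 * - ?f (1 / x))"
      by (rule arg_cong)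
    also have "\<dots> = quad_char (- ?f (1 / x))"
      by (rule quad_char_square_mult[OF odd]) (use that in simp)
    finally show ?thesis
      by (simp only: neg)
  qed
  have neg': "quad_char (?f (- x)) = quad_char (?f x)" for x
    using neg[of "?f x"] by simp
  have sub: "orb x \<subseteq> ?M" if "x \<in> ?M" for x
    using that inv[OF nz[OF that]] neg'[of x] neg'[of "1 / x"] by (auto simp: orb_def)
  have card: "card (orb x) = 4" if "x \<in> ?M" for x
  proof -
    have "x \<noteq> 0" using nz that by blast
    have "x ^ 2 \<noteq> 1" using that by auto
    have "x ^ 2 \<noteq> - 1"
    proof
      assume "x ^ 2 = - 1"
      then have "?f x = (1 - x) ^ 2"
        by (simp add: power2_diff)
      then have "is_square (?f x)"
        by (metis is_nth_power_nth_power)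
      then show False
        using that by (simp add: not_square_iff [symmetric])
    qed
    have "x \<noteq> - x"
      using one_neq_minus_one[OF odd] \<open>x \<noteq> 0\<close>
      by (metis mult.right_neutral mult_cancel_left mult_minus_right)
    then have "1 / x \<noteq> - (1 / x)"
      using \<open>x \<noteq> 0\<close> by (simp add: field_simps)
    moreover have "- (x ^ 2) \<noteq> 1"
      using \<open>x ^ 2 \<noteq> - 1\<close> by (metis minus_minus)
    then have "x \<noteq> 1 / x" "x \<noteq> - (1 / x)" "- x \<noteq> 1 / x" "- x \<noteq> - (1 / x)"
      using \<open>x \<noteq> 0\<close> \<open>x ^ 2 \<noteq> 1\<close> \<open>x ^ 2 \<noteq> - 1\<close>
      by (auto simp: field_simps power2_eq_square)
    ultimately show ?thesis
      using \<open>x \<noteq> - x\<close> by (simp add: orb_def)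
  qed
  have refl: "x \<in> orb x" for x by (simp add: orb_def)
  have "orb z = orb x" if "z \<in> orb x" for x z
    using that by (auto simp: orb_def)
  then have disj: "orb x = orb y \<or> orb x \<inter> orb y = {}" for x y
    by blast
  have "4 dvd card (\<Union> (orb ` ?M))"
    by (rule dvd_partition) (use card disj in auto)
  also have "\<Union> (orb ` ?M) = ?M"
    using sub refl by blast
  finally show ?thesis .
qed

text \<open>
  If every value \<open>\<chi>(x\<^sup>3 - x)\<close> outside the three zeros were \<open>1\<close>, the sum would be \<open>Q - 3\<close>; each value
  \<open>-1\<close> lowers it by \<open>2\<close>, and the number of these is a multiple of \<open>4\<close>.
\<close>

lemma jacobsthal_sum_cong_8:
  assumes mod: "CARD('a::finite_field) mod 4 = 1"
  shows "[jacobsthal_sum (1::'a) = int CARD('a) - 3] (mod 8)"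
proof -
  have odd: "odd CARD('a)" using mod by presburger
  let ?f = "\<lambda>x::'a. x * (x ^ 2 - 1)"
  let ?M = "{x. quad_char (?f x) = - 1}"
  have zeros: "{x. ?f x = 0} = {0, 1, - 1}"
    by (auto simp: power2_eq_1_iff)
  have "jacobsthal_sum (1::'a)
      = (\<Sum>x\<in>UNIV. 1 - (if ?f x = 0 then 1 else 0) - (if quad_char (?f x) = - 1 then 2 else 0))"
    unfolding jacobsthal_sum_def by (intro sum.cong refl) (simp add: quad_char_def)
  also have "\<dots> = int CARD('a) - int (card {x. ?f x = 0}) - 2 * int (card ?M)"
    by (simp add: sum_subtractf sum.If_cases del: mult_eq_0_iff)
  also have "card {x. ?f x = 0} = 3"
    unfolding zeros using one_neq_minus_one[OF odd] by simp
  finally have "jacobsthal_sum (1::'a) - (int CARD('a) - 3) = - 2 * int (card ?M)"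
    by simp
  moreover obtain k where "card ?M = 4 * k"
    using four_dvd_card_jacobsthal_minus[OF mod] by (auto elim: dvdE)
  ultimately have "jacobsthal_sum (1::'a) - (int CARD('a) - 3) = 8 * - int k"
    by simp
  then show ?thesis
    unfolding cong_iff_dvd_diff by (metis dvd_triv_left)
qed

section \<open>The Jacobsthal sum modulo the characteristic\<close>

text \<open>
  One step of Legendre's formula: the multiples of \<open>p\<close> among \<open>1, \<dots>, p * n + c\<close> multiply to
  \<open>p ^ n * fact n\<close>, and the other factors are prime to \<open>p\<close>.
\<close>

lemma fact_mult_prime_add:
  fixes p n c :: nat
  assumes p: "prime p" and "c < p"
  shows "\<exists>u. \<not> p dvd u \<and> fact (p * n + c) = p ^ n * fact n * u"
  using \<open>c < p\<close>
proof (induction n arbitrary: c)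
  case 0
  then show ?case
    using p by (auto simp: prime_dvd_fact_iff)
next
  case (Suc n)
  have "p > 0" using p by (simp add: prime_gt_0_nat)
  from Suc.prems show ?case
  proof (induction c)
    case 0
    obtain u where u: "\<not> p dvd u" "fact (p * n + (p - 1)) = p ^ n * fact n * u"
      using Suc.IH[of "p - 1"] \<open>p > 0\<close> by auto
    have "p * Suc n + 0 = Suc (p * n + (p - 1))"
      using \<open>p > 0\<close> by simp
    then have "fact (p * Suc n + 0) = (p * Suc n + 0) * fact (p * n + (p - 1))"
      by (metis fact_Suc of_nat_id)
    then have "fact (p * Suc n + 0) = p ^ Suc n * fact (Suc n) * u"
      unfolding u(2) by (simp add: algebra_simps)
    with u(1) show ?case by blast
  next
    case (Suc c)
    then obtain u where u: "\<not> p dvd u" "fact (p * Suc n + c) = p ^ Suc n * fact (Suc n) * u"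
      using Suc.IH by auto
    have "\<not> p dvd p * Suc n + Suc c"
      using Suc.prems by (metis dvd_add_right_iff dvd_triv_left nat_dvd_not_less zero_less_Suc)
    then have "\<not> p dvd (p * Suc n + Suc c) * u"
      using u(1) p prime_dvd_mult_nat by blast
    moreover have "fact (p * Suc n + Suc c) = p ^ Suc n * fact (Suc n) * ((p * Suc n + Suc c) * u)"
      using u(2) by (simp only: add_Suc_right fact_Suc) (simp add: algebra_simps)
    ultimately show ?case by blast
  qed
qed

text \<open>
  The instance of Lucas' theorem for central binomial coefficients in which the last base-\<open>p\<close> digit
  \<open>d\<close> doubles without a carry.
\<close>

lemma prime_dvd_central_binomial_step:
  fixes p m d :: nat
  assumes p: "prime p" and "2 * d < p"
    and dvd: "p dvd (2 * (p * m + d)) choose (p * m + d)"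
  shows "p dvd (2 * m) choose m"
proof -
  define C where "C = (2 * (p * m + d)) choose (p * m + d)"
  obtain u where u: "\<not> p dvd u" "fact (p * (2 * m) + 2 * d) = p ^ (2 * m) * fact (2 * m) * u"
    using fact_mult_prime_add[OF p assms(2)] by blast
  obtain v where v: "fact (p * m + d) = p ^ m * fact m * v"
    using fact_mult_prime_add[OF p, of d m] assms(2) by auto
  have cb: "fact k * fact k * ((2 * k) choose k) = (fact (2 * k) :: nat)" for k
    using binomial_fact_lemma[of k "2 * k"] by simp
  have "fact (p * m + d) * fact (p * m + d) * C = (fact (p * (2 * m) + 2 * d) :: nat)"
    unfolding C_def by (subst cb) (simp add: algebra_simps)
  then have "(p ^ m * fact m) ^ 2 * (v ^ 2 * C) = p ^ (2 * m) * fact (2 * m) * u"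
    unfolding u v by (simp add: power2_eq_square algebra_simps)
  also have "\<dots> = (p ^ m * fact m) ^ 2 * (((2 * m) choose m) * u)"
    unfolding cb [symmetric] power_even_eq
    by (simp add: power2_eq_square algebra_simps)
  finally have "v ^ 2 * C = ((2 * m) choose m) * u"
    using p by (simp add: prime_gt_0_nat)
  with dvd have "p dvd ((2 * m) choose m) * u"
    unfolding C_def by (metis dvd_mult)
  with u(1) p show ?thesis
    by (simp add: prime_dvd_mult_iff)
qed

text \<open>
  All base-\<open>p\<close> digits of \<open>(p\<^sup>r - 1) / 4\<close> equal \<open>(p - 1) / 4\<close>, so that doubling it causes no carries.
\<close>

lemma prime_not_dvd_central_binomial:
  fixes p r :: nat
  assumes p: "prime p" and "p mod 4 = 1"
  shows "\<not> p dvd (2 * ((p ^ r - 1) div 4)) choose ((p ^ r - 1) div 4)"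
proof (induction r)
  case 0
  then show ?case using p by auto
next
  case (Suc r)
  have "p ^ r mod 4 = 1"
    using power_mod[of p 4 r] assms(2) by simp
  then obtain k where k: "p ^ r = 4 * k + 1"
    by (metis div_mod_decomp mult.commute)
  obtain d where d: "p = 4 * d + 1"
    using assms(2) by (metis div_mod_decomp mult.commute)
  have "p ^ Suc r = p * (4 * k + 1)"
    by (simp add: k)
  also have "\<dots> = 4 * (p * k + d) + 1"
    using d by (simp add: algebra_simps)
  finally have "(p ^ Suc r - 1) div 4 = p * k + d"
    by simp
  moreover have "(p ^ r - 1) div 4 = k"
    by (simp add: k)
  ultimately show ?case
    using Suc.IH prime_dvd_central_binomial_step[OF p, of d k] d by auto
qed

text \<open>
  If \<open>Q - 1\<close> does not divide \<open>k\<close>, then some \<open>u \<noteq> 0\<close> has \<open>u\<^sup>k \<noteq> 1\<close>, because \<open>X\<^sup>m - 1\<close> with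
  \<open>m = k mod (Q - 1)\<close> has too few roots; multiplying all \<open>x\<close> by \<open>u\<close> shows that the sum vanishes.
\<close>

lemma sum_powers_finite_field:
  assumes "k > 0"
  shows "(\<Sum>x::'a::finite_field\<in>UNIV. x ^ k) = (if (CARD('a) - 1) dvd k then - 1 else 0)"
proof (cases "(CARD('a) - 1) dvd k")
  case True
  then obtain l where l: "k = (CARD('a) - 1) * l" by (elim dvdE)
  have "(\<Sum>x::'a\<in>UNIV. x ^ k) = (\<Sum>x\<in>UNIV - {0::'a}. 1)"
    by (rule sum.mono_neutral_cong_right)
      (use assms in \<open>auto simp: l power_mult power_card_minus_one simp del: One_nat_def\<close>)
  also have "\<dots> = of_nat CARD('a) - 1"
    by (simp add: card_Diff_singleton of_nat_diff Suc_leI)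
  also have "(of_nat CARD('a) :: 'a) = 0"
    using CHAR_dvd_CARD[where 'a = 'a] by (simp add: of_nat_eq_0_iff_char_dvd)
  finally show ?thesis using True by simp
next
  case False
  define m where "m = k mod (CARD('a) - 1)"
  have pos: "CARD('a) - 1 > 0"
    using card_finite_field_gt_1[where 'a = 'a] by simp
  have m: "m > 0" "m < CARD('a) - 1"
    using False pos by (auto simp: m_def dvd_eq_mod_eq_0)
  obtain u :: 'a where u: "u \<noteq> 0" "u ^ m \<noteq> 1"
  proof (rule ccontr)
    assume "\<not> thesis"
    then have "UNIV - {0::'a} \<subseteq> {x. x ^ m = 1}"
      using that by blast
    then have "card (UNIV - {0::'a}) \<le> card {x::'a. x ^ m = 1}"
      by (intro card_mono) auto
    also have "\<dots> \<le> m"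
      by (rule card_power_eq_one_le[OF m(1)])
    finally show False
      using m(2) by (simp add: card_Diff_singleton)
  qed
  have "u ^ k = u ^ ((CARD('a) - 1) * (k div (CARD('a) - 1)) + m)"
    unfolding m_def by (simp only: mult_div_mod_eq)
  then have "u ^ k = u ^ m"
    by (simp only: power_add power_mult power_card_minus_one[OF u(1)] power_one mult_1)
  then have uk: "u ^ k \<noteq> 1"
    using u by simp
  have "(\<Sum>x\<in>UNIV. x ^ k) = (\<Sum>x\<in>UNIV. (u * x) ^ k)"
    by (rule sum.reindex_bij_witness[of _ "\<lambda>x. u * x" "\<lambda>x. x / u"]) (use u in auto)
  also have "\<dots> = u ^ k * (\<Sum>x\<in>UNIV. x ^ k)"
    by (simp add: power_mult_distrib sum_distrib_left)
  finally have "(1 - u ^ k) * (\<Sum>x\<in>UNIV. x ^ k) = 0"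
    by (simp add: algebra_simps)
  then show ?thesis
    using uk False by simp
qed

text \<open>
  By Euler's criterion the sum is \<open>\<Sum>x. (x\<^sup>3 - x) ^ (2 * m)\<close> in the field. Expanding, only exponents
  divisible by \<open>Q - 1 = 4 * m\<close> survive summation over \<open>x\<close>. The exponents lie between \<open>2 * m\<close> and
  \<open>6 * m\<close>, so the middle term is the only one.
\<close>

lemma jacobsthal_sum_cong_binomial:
  assumes m: "CARD('a::finite_field) = 4 * m + 1"
  shows "(of_int (jacobsthal_sum (1::'a)) :: 'a) = - ((- 1) ^ m * of_nat ((2 * m) choose m))"
proof -
  have odd: "odd CARD('a)" using m by simp
  have half: "(CARD('a) - 1) div 2 = 2 * m" using m by simp
  have "m > 0"
    using card_finite_field_gt_1[where 'a = 'a] m by simp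
  have expand: "(x * (x ^ 2 - 1)) ^ (2 * m)
      = (\<Sum>k\<le>2 * m. of_nat ((2 * m) choose k) * (- 1) ^ (2 * m - k) * x ^ (2 * m + 2 * k))"
    for x :: 'a
  proof -
    have "(x * (x ^ 2 - 1)) ^ (2 * m) = x ^ (2 * m) * (x ^ 2 + - 1) ^ (2 * m)"
      by (simp add: power_mult_distrib)
    also have "\<dots> = (\<Sum>k\<le>2 * m. of_nat ((2 * m) choose k) * (- 1) ^ (2 * m - k) * x ^ (2 * m + 2 * k))"
      unfolding binomial_ring sum_distrib_left
      by (intro sum.cong refl) (simp add: power_add power_mult power_mult_distrib power2_eq_square mult_ac)
    finally show ?thesis .
  qed
  have "(of_int (jacobsthal_sum (1::'a)) :: 'a) = (\<Sum>x\<in>UNIV. (x * (x ^ 2 - 1)) ^ (2 * m))"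
    unfolding jacobsthal_sum_def of_int_sum euler_criterion[OF odd] half ..
  also have "\<dots> = (\<Sum>k\<le>2 * m. of_nat ((2 * m) choose k) * (- 1) ^ (2 * m - k)
      * (\<Sum>x::'a\<in>UNIV. x ^ (2 * m + 2 * k)))"
    unfolding expand by (subst sum.swap) (simp add: sum_distrib_left)
  also have "\<dots> = (\<Sum>k\<in>{m}. - (of_nat ((2 * m) choose k) * (- 1) ^ (2 * m - k)))"
  proof (rule sum.mono_neutral_cong_right)
    have "(\<Sum>x::'a\<in>UNIV. x ^ (2 * m + 2 * k)) = 0" if "k \<le> 2 * m" "k \<noteq> m" for k
    proof -
      have "\<not> 4 * m dvd 2 * m + 2 * k"
      proof
        assume "4 * m dvd 2 * m + 2 * k"
        then obtain t where t: "2 * m + 2 * k = 4 * m * t" by (elim dvdE)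
        then have "m + k = 2 * m * t" by simp
        moreover have "t \<noteq> 0" using t \<open>m > 0\<close> by (intro notI) simp
        moreover have "t \<noteq> 1" using t that by (intro notI) simp
        moreover have "2 * m * 2 \<le> 2 * m * t" if "t \<ge> 2"
          using that by (intro mult_le_mono2)
        ultimately show False using that \<open>m > 0\<close> by linarith
      qed
      then show ?thesis
        using \<open>m > 0\<close> by (subst sum_powers_finite_field) (auto simp: m)
    qed
    then show "\<forall>k\<in>{..2 * m} - {m}. of_nat ((2 * m) choose k) * (- 1) ^ (2 * m - k)
        * (\<Sum>x::'a\<in>UNIV. x ^ (2 * m + 2 * k)) = 0"
      by simp
    have "(\<Sum>x::'a\<in>UNIV. x ^ (2 * m + 2 * m)) = - 1"
      using \<open>m > 0\<close> by (subst sum_powers_finite_field) (auto simp: m)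
    then show "of_nat ((2 * m) choose k) * (- 1) ^ (2 * m - k) * (\<Sum>x::'a\<in>UNIV. x ^ (2 * m + 2 * k))
        = - (of_nat ((2 * m) choose k) * (- 1) ^ (2 * m - k))" if "k \<in> {m}" for k
      using that by simp
  qed auto
  finally show ?thesis
    by (simp add: mult.commute)
qed

lemma CHAR_eq_prime:
  assumes "prime p" and "CARD('a::finite_field) = p ^ r"
  shows "CHAR('a) = p"
proof -
  have "CHAR('a) dvd p ^ r"
    using CHAR_dvd_CARD[where 'a = 'a] assms by simp
  then have "CHAR('a) dvd p"
    by (rule prime_dvd_power[OF CHAR_prime])
  then show ?thesis
    using assms(1) by (intro primes_dvd_imp_eq) auto
qed

text \<open>
  Equality would force \<open>p\<close> to divide the sum, whereas modulo \<open>p\<close> the sum is, up to sign, a central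
  binomial coefficient prime to \<open>p\<close>. In geometric terms, \<open>y\<^sup>2 = x\<^sup>3 - x\<close> is ordinary when
  \<open>p \<equiv> 1\<close> modulo \<open>4\<close>.
\<close>

lemma jacobsthal_sum_not_extremal:
  assumes p: "prime p" "p mod 4 = 1" and card: "CARD('a::finite_field) = p ^ r" and "r > 0"
  shows "jacobsthal_sum (1::'a) ^ 2 \<noteq> 4 * int CARD('a)"
proof
  assume "jacobsthal_sum (1::'a) ^ 2 = 4 * int CARD('a)"
  then have "int p dvd jacobsthal_sum (1::'a) ^ 2"
    using \<open>r > 0\<close> by (simp add: card dvd_mult dvd_power)
  moreover have "prime (int p)"
    using p by simp
  ultimately have "int p dvd jacobsthal_sum (1::'a)"
    by (meson prime_dvd_power)
  then obtain z where z: "jacobsthal_sum (1::'a) = int p * z"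
    by (elim dvdE)
  have char: "CHAR('a) = p"
    by (rule CHAR_eq_prime[OF p(1) card])
  then have "of_nat p = (0::'a)"
    by (metis of_nat_CHAR)
  then have "of_int (jacobsthal_sum (1::'a)) = (0::'a)"
    by (simp add: z)
  define m where "m = (p ^ r - 1) div 4"
  have "CARD('a) mod 4 = 1"
    using power_mod[of p 4 r] p by (simp add: card)
  then have "CARD('a) = 4 * m + 1"
    unfolding m_def card by presburger
  from jacobsthal_sum_cong_binomial[OF this]
  have "of_nat ((2 * m) choose m) = (0::'a)"
    using \<open>of_int (jacobsthal_sum (1::'a)) = (0::'a)\<close> by simp
  then have "p dvd (2 * m) choose m"
    by (simp only: of_nat_eq_0_iff_char_dvd char)
  then show False
    using prime_not_dvd_central_binomial[OF p, of r] by (simp add: m_def)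
qed

section \<open>Attaining the Hasse bound\<close>

text \<open>
  A prime \<open>p \<equiv> 3\<close> modulo \<open>4\<close> dividing a sum of two squares divides both, which allows descent on
  \<open>s\<close>. In other words, \<open>p\<close> is inert in the Gaussian integers.
\<close>

lemma sum_squares_eq_prime_power:
  fixes p s a b :: nat
  assumes p: "prime p" and p3: "p mod 4 = 3" and "a ^ 2 + b ^ 2 = p ^ (2 * s)"
  shows "a = 0 \<or> b = 0"
  using assms(3)
proof (induction s arbitrary: a b)
  case 0
  then show ?case
    by (cases a; cases b) (auto simp: power2_eq_square)
next
  case (Suc s)
  define k where "k = (p - 1) div 2"
  have "p > 0" using p by (simp add: prime_gt_0_nat)
  have k: "odd k" "p - 1 = 2 * k"
    using p3 unfolding k_def by presburger+
  have dvd: "p dvd a ^ 2 + b ^ 2"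
    unfolding Suc.prems by simp
  have not2: "\<not> p dvd 2"
    using p3 p primes_dvd_imp_eq[OF p two_is_prime_nat] by auto
  have "p dvd a \<and> p dvd b"
  proof (rule ccontr)
    assume "\<not> (p dvd a \<and> p dvd b)"
    then have "\<not> p dvd a" "\<not> p dvd b"
      using dvd p by (metis dvd_add_right_iff dvd_add_left_iff prime_dvd_power_nat dvd_power zero_less_numeral dvd_trans)+
    then have "[a ^ (p - 1) + b ^ (p - 1) = 1 + 1] (mod p)"
      by (intro cong_add fermat_theorem p)
    \<comment> \<open>\<open>(p - 1) / 2\<close> is odd, so \<open>a\<^sup>2 + b\<^sup>2\<close> divides this sum, which contradicts Fermat's theorem.\<close>
    moreover have "p dvd a ^ (p - 1) + b ^ (p - 1)"
    proof -
      have "int (a ^ 2) - (- int (b ^ 2)) dvd int (a ^ 2) ^ k - (- int (b ^ 2)) ^ k"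
        unfolding power_diff_sumr2 by (rule dvd_triv_left)
      then have "int (a ^ 2 + b ^ 2) dvd int ((a ^ 2) ^ k + (b ^ 2) ^ k)"
        using k(1) by simp
      then have "a ^ 2 + b ^ 2 dvd (a ^ 2) ^ k + (b ^ 2) ^ k"
        by (simp only: int_dvd_int_iff)
      with dvd show ?thesis
        unfolding k(2) power_mult by (rule dvd_trans)
    qed
    ultimately have "p dvd 1 + 1"
      using cong_dvd_iff by blast
    then show False using not2 by (simp add: numeral_2_eq_2)
  qed
  then obtain a' b' where ab: "a = p * a'" "b = p * b'"
    by (auto elim!: dvdE)
  have "p ^ 2 * (a' ^ 2 + b' ^ 2) = p ^ 2 * p ^ (2 * s)"
    using Suc.prems unfolding ab by (simp add: power_mult_distrib algebra_simps power2_eq_square)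
  then have "a' ^ 2 + b' ^ 2 = p ^ (2 * s)"
    using \<open>p > 0\<close> by simp
  then show ?case
    using Suc.IH[of a' b'] ab by auto
qed

lemma jacobsthal_sum_decomposition:
  assumes mod: "CARD('a::finite_field) mod 4 = 1"
  obtains A B :: int where "jacobsthal_sum (1::'a) = 2 * A" "A ^ 2 + B ^ 2 = int CARD('a)"
    "[2 * A = int CARD('a) - 3] (mod 8)"
proof -
  have odd: "odd CARD('a)" using mod by presburger
  obtain g :: 'a where g: "quad_char g = - 1"
    using ex_nonsquare[OF odd] by blast
  let ?S = "jacobsthal_sum (1::'a)" and ?T = "jacobsthal_sum g"
  have ST: "?S ^ 2 + ?T ^ 2 = 4 * int CARD('a)"
    by (rule jacobsthal_two_squares[OF mod g])
  have c8: "[?S = int CARD('a) - 3] (mod 8)"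
    by (rule jacobsthal_sum_cong_8[OF mod])
  have "even (int CARD('a) - 3)" using odd by simp
  then have "even ?S"
    using c8 cong_dvd_iff[of ?S "int CARD('a) - 3" 2] cong_dvd_modulus[OF c8, of 2] by auto
  then obtain A where A: "?S = 2 * A" by (elim evenE)
  have "even (?S ^ 2 + ?T ^ 2)" unfolding ST by simp
  then have "even ?T" unfolding A by simp
  then obtain B where B: "?T = 2 * B" by (elim evenE)
  have "A ^ 2 + B ^ 2 = int CARD('a)"
    using ST unfolding A B by (simp add: power_mult_distrib)
  then show ?thesis
    using that A c8 by simp
qed

text \<open>
  Half the sum, \<open>A\<close>, is part of a representation \<open>A\<^sup>2 + B\<^sup>2 = p\<^sup>2\<^sup>s\<close>, which must be trivial; being odd,
  \<open>A\<close> is \<open>\<plusminus>p\<^sup>s\<close>. The congruence modulo \<open>8\<close> gives \<open>A \<equiv> -1\<close> modulo \<open>4\<close> and so decides the sign,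
  since \<open>P = (-p)\<^sup>s\<close> satisfies \<open>P \<equiv> 1\<close> modulo \<open>4\<close>.
\<close>

lemma jacobsthal_sum_prime_3_mod_4:
  assumes p: "prime p" "p mod 4 = 3" and card: "CARD('a::finite_field) = p ^ (2 * s)"
  shows "jacobsthal_sum (1::'a) = - 2 * (- int p) ^ s"
proof -
  define P where "P = (- int p) ^ s"
  have P2: "int CARD('a) = P ^ 2"
    unfolding card P_def by (simp add: power_even_eq power_mult [symmetric] mult.commute)
  have "int p mod 4 = 3"
    using p(2) by presburger
  then have "[- int p = 1] (mod 4)"
    by (auto simp: cong_iff_dvd_diff) presburger
  then have "[P = 1 ^ s] (mod 4)"
    unfolding P_def by (rule cong_pow)
  then have P4: "P mod 4 = 1"
    by (simp add: cong_def)
  have "[P ^ 2 = 1] (mod 8)"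
  proof -
    define l where "l = P div 4"
    have "P = 4 * l + 1"
      unfolding l_def using P4 by presburger
    then have "P ^ 2 - 1 = 8 * (2 * l ^ 2 + l)"
      by (simp add: power2_eq_square algebra_simps)
    then show ?thesis
      unfolding cong_iff_dvd_diff by (metis dvd_triv_left)
  qed
  then have P8: "P ^ 2 mod 8 = 1"
    by (simp add: cong_def)
  have "CARD('a) mod 4 = 1"
  proof -
    have "int CARD('a) mod 8 = 1" using P8 P2 by simp
    then show ?thesis by presburger
  qed
  then obtain A B where AB: "jacobsthal_sum (1::'a) = 2 * A" "A ^ 2 + B ^ 2 = int CARD('a)"
    "[2 * A = int CARD('a) - 3] (mod 8)"
    by (rule jacobsthal_sum_decomposition)
  have "(2 * A) mod 8 = (P ^ 2 - 3) mod 8"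
    using AB(3) by (simp add: cong_def P2)
  then have A4: "A mod 4 = 3"
    using P8 by presburger
  have "int (nat \<bar>A\<bar> ^ 2 + nat \<bar>B\<bar> ^ 2) = int (p ^ (2 * s))"
    using AB(2) by (simp add: card)
  then have "nat \<bar>A\<bar> ^ 2 + nat \<bar>B\<bar> ^ 2 = p ^ (2 * s)"
    by (simp only: of_nat_eq_iff)
  then have "nat \<bar>A\<bar> = 0 \<or> nat \<bar>B\<bar> = 0"
    by (rule sum_squares_eq_prime_power[OF p])
  moreover have "A \<noteq> 0" using A4 by auto
  ultimately have "B = 0" by simp
  then have "A ^ 2 = P ^ 2" using AB(2) P2 by simp
  then have "A = P \<or> A = - P" by (simp add: power2_eq_iff)
  moreover have "A \<noteq> P" using A4 P4 by auto
  ultimately show ?thesis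
    using AB(1) by (simp add: P_def)
qed

lemma jacobsthal_sum_eq_extremal_iff:
  assumes p: "prime p" "odd p" and card: "CARD('a::finite_field) = p ^ r" and "r > 0"
    and mod: "CARD('a) mod 4 = 1"
  shows "real_of_int (jacobsthal_sum (1::'a)) = 2 * sqrt (real CARD('a))
    \<longleftrightarrow> p mod 4 = 3 \<and> (\<exists>s. odd s \<and> r = 2 * s)"
proof (cases "p mod 4 = 1")
  case True
  have "jacobsthal_sum (1::'a) ^ 2 = 4 * int CARD('a)"
    if "real_of_int (jacobsthal_sum (1::'a)) = 2 * sqrt (real CARD('a))"
  proof -
    have "real_of_int (jacobsthal_sum (1::'a) ^ 2) = real_of_int (4 * int CARD('a))"
      using that by (simp add: power_mult_distrib)
    then show ?thesis by (simp only: of_int_eq_iff)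
  qed
  then show ?thesis
    using jacobsthal_sum_not_extremal[OF p(1) True card \<open>r > 0\<close>] True by auto
next
  case False
  then have p3: "p mod 4 = 3" using p(2) by presburger
  have "even r"
  proof (rule ccontr)
    assume "odd r"
    have "int p mod 4 = 3" using p3 by presburger
    then have "[int p = - 1] (mod 4)"
      by (simp add: cong_def)
    then have "[int p ^ r = (- 1) ^ r] (mod 4)"
      by (rule cong_pow)
    then have "int (p ^ r) mod 4 = 3"
      using \<open>odd r\<close> by (simp add: cong_def)
    then show False
      using mod unfolding card by presburger
  qed
  then obtain s where s: "r = 2 * s" by (elim evenE)
  have S: "jacobsthal_sum (1::'a) = - 2 * (- int p) ^ s"
    using jacobsthal_sum_prime_3_mod_4[OF p(1) p3] card s by simp
  have "sqrt (real CARD('a)) = real p ^ s"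
    unfolding card s by (simp add: power_even_eq)
  moreover have "real p ^ s > 0"
    using p(1) by (simp add: prime_gt_0_nat)
  ultimately have "real_of_int (jacobsthal_sum (1::'a)) = 2 * sqrt (real CARD('a)) \<longleftrightarrow> odd s"
    unfolding S by (cases "even s") auto
  then show ?thesis
    using p3 s by auto
qed

section \<open>Counting triples of consecutive non-squares\<close>

text \<open>
  The product \<open>(1 - \<chi>(\<gamma> - 1)) (1 - \<chi>(\<gamma>)) (1 - \<chi>(\<gamma> + 1))\<close> is \<open>8\<close> at the middle of a triple and
  \<open>0\<close> elsewhere, except possibly at the three points where a character value is \<open>0\<close>. At \<open>0\<close> and
  \<open>1\<close> the factor \<open>1 - \<chi>(1)\<close> annihilates it, so only \<open>\<gamma> = -1\<close> gives a correction. Expanding the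
  product, the linear terms sum to \<open>0\<close>, each of the three quadratic ones to \<open>-1\<close>, and the cubic
  one is the Jacobsthal sum at \<open>1\<close>.
\<close>

lemma nonsquare_triple_count_eq:
  assumes odd: "odd CARD('a::finite_field)"
  shows "8 * int (nonsquare_triple_count TYPE('a))
      = int CARD('a) - 3 - jacobsthal_sum (1::'a) - (1 - quad_char (- 1 :: 'a)) * (1 - quad_char (- 2 :: 'a))"
proof -
  let ?\<chi> = "quad_char :: 'a \<Rightarrow> int"
  let ?P = "\<lambda>\<gamma>::'a. \<not> is_square (\<gamma> - 1) \<and> \<not> is_square \<gamma> \<and> \<not> is_square (\<gamma> + 1)"
  let ?w = "\<lambda>\<gamma>. (1 - ?\<chi> (\<gamma> - 1)) * (1 - ?\<chi> \<gamma>) * (1 - ?\<chi> (\<gamma> + 1))"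
  have "?w \<gamma> = (if ?P \<gamma> then 8 else 0) + (if \<gamma> = - 1 then (1 - ?\<chi> (- 1)) * (1 - ?\<chi> (- 2)) else 0)"
    for \<gamma> :: 'a
  proof -
    consider "\<gamma> = 0" | "\<gamma> = 1" | "\<gamma> = - 1" | "\<gamma> \<noteq> 0" "\<gamma> \<noteq> 1" "\<gamma> \<noteq> - 1" by blast
    then show ?thesis
    proof cases
      case 4
      then have "?\<chi> (\<gamma> - 1) \<in> {- 1, 1}" "?\<chi> \<gamma> \<in> {- 1, 1}" "?\<chi> (\<gamma> + 1) \<in> {- 1, 1}"
        by (auto simp: quad_char_def add_eq_0_iff2)
      with 4 show ?thesis
        by (auto simp: not_square_iff)
    qed (use one_neq_minus_one[OF odd] in \<open>auto simp: not_square_iff\<close>)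
  qed
  then have "(\<Sum>\<gamma>\<in>UNIV. ?w \<gamma>) = (\<Sum>\<gamma>\<in>UNIV. if ?P \<gamma> then 8 else 0)
      + (\<Sum>\<gamma>::'a\<in>UNIV. if \<gamma> = - 1 then (1 - ?\<chi> (- 1)) * (1 - ?\<chi> (- 2)) else 0)"
    by (simp only: sum.distrib)
  also have "(\<Sum>\<gamma>\<in>UNIV. if ?P \<gamma> then 8 else 0) = 8 * int (card {\<gamma>. ?P \<gamma>})"
    by (simp add: sum.If_cases)
  finally have lhs: "(\<Sum>\<gamma>\<in>UNIV. ?w \<gamma>) = 8 * int (nonsquare_triple_count TYPE('a))
      + (1 - ?\<chi> (- 1)) * (1 - ?\<chi> (- 2))"
    by (simp add: nonsquare_triple_count_def)
  have shift: "(\<Sum>\<gamma>\<in>UNIV. ?\<chi> (\<gamma> + a)) = 0" for a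
  proof -
    have "(\<Sum>\<gamma>\<in>UNIV. ?\<chi> (\<gamma> + a)) = (\<Sum>\<gamma>\<in>UNIV. ?\<chi> \<gamma>)"
      by (rule sum.reindex_bij_witness[of _ "\<lambda>x. x - a" "\<lambda>x. x + a"]) auto
    then show ?thesis by (simp add: sum_quad_char[OF odd])
  qed
  have pair: "(\<Sum>\<gamma>\<in>UNIV. ?\<chi> ((\<gamma> - a) * (\<gamma> - b))) = - 1" if "a \<noteq> b" for a b
    using sum_quad_char_quadratic[OF odd, of a b] that by simp
  have expand: "?w \<gamma> = 1 - ?\<chi> (\<gamma> + - 1) - ?\<chi> (\<gamma> + 0) - ?\<chi> (\<gamma> + 1)
      + ?\<chi> ((\<gamma> - 1) * (\<gamma> - 0)) + ?\<chi> ((\<gamma> - 1) * (\<gamma> - - 1)) + ?\<chi> ((\<gamma> - 0) * (\<gamma> - - 1))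
      - ?\<chi> (\<gamma> * (\<gamma> ^ 2 - 1))" for \<gamma>
  proof -
    have "?\<chi> (\<gamma> * (\<gamma> ^ 2 - 1)) = ?\<chi> (\<gamma> - 1) * ?\<chi> \<gamma> * ?\<chi> (\<gamma> + 1)"
      by (simp add: quad_char_mult[OF odd, symmetric] algebra_simps power2_eq_square)
    moreover have "?\<chi> ((\<gamma> - 1) * (\<gamma> - 0)) = ?\<chi> (\<gamma> - 1) * ?\<chi> \<gamma>"
      "?\<chi> ((\<gamma> - 1) * (\<gamma> - - 1)) = ?\<chi> (\<gamma> - 1) * ?\<chi> (\<gamma> + 1)"
      "?\<chi> ((\<gamma> - 0) * (\<gamma> - - 1)) = ?\<chi> \<gamma> * ?\<chi> (\<gamma> + 1)"
      by (simp_all only: quad_char_mult[OF odd] diff_zero diff_minus_eq_add)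
    ultimately show ?thesis
      by (simp add: algebra_simps)
  qed
  have "(\<Sum>\<gamma>\<in>UNIV. ?w \<gamma>) = int CARD('a) - 3 - jacobsthal_sum (1::'a)"
    unfolding expand sum_subtractf sum.distrib shift jacobsthal_sum_def
    using one_neq_minus_one[OF odd] by (subst (1 2 3) pair) auto
  with lhs show ?thesis by simp
qed

text \<open>
  For \<open>Q \<in> {3, 7}\<close> the count is below \<open>1\<close> because the Jacobsthal sum vanishes. For \<open>Q \<in> {5, 9}\<close> the
  two-square representation and the congruence modulo \<open>8\<close> leave only one value for the sum.
\<close>

lemma nonsquare_triple_count_small:
  assumes odd: "odd CARD('a::finite_field)" and small: "CARD('a) \<le> 9"
  shows "nonsquare_triple_count TYPE('a) = 0"
proof (cases "CARD('a) mod 4 = 1")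
  case False
  have "(1 - quad_char (- 1 :: 'a)) * (1 - quad_char (- 2 :: 'a)) \<ge> 0"
    using quad_char_values[of "- 1 :: 'a"] quad_char_values[of "- 2 :: 'a"] by auto
  then have "8 * int (nonsquare_triple_count TYPE('a)) \<le> int CARD('a) - 3"
    using nonsquare_triple_count_eq[OF odd] jacobsthal_sum_eq_0[OF odd False, of 1] by simp
  moreover have "CARD('a) \<noteq> 9" using False by auto
  ultimately show ?thesis using small odd by linarith
next
  case True
  have Q: "CARD('a) = 5 \<or> CARD('a) = 9"
    using card_finite_field_gt_1[where 'a = 'a] True small by presburger
  obtain A B where AB: "jacobsthal_sum (1::'a) = 2 * A" "A ^ 2 + B ^ 2 = int CARD('a)"
    "[2 * A = int CARD('a) - 3] (mod 8)"
    using jacobsthal_sum_decomposition[OF True] by metis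
  have N: "8 * int (nonsquare_triple_count TYPE('a)) = int CARD('a) - 3 - 2 * A"
    using nonsquare_triple_count_eq[OF odd] AB(1) True by (simp add: quad_char_minus_one[OF odd])
  have bound: "\<bar>x\<bar> < 4" if "x ^ 2 \<le> 9" for x :: int
    using that by (intro power2_less_imp_less[of "\<bar>x\<bar>" 4]) auto
  have "A ^ 2 \<le> 9" "B ^ 2 \<le> 9"
    using AB(2) small zero_le_power2[of A] zero_le_power2[of B] by linarith+
  then have "A \<in> {- 3, - 2, - 1, 0, 1, 2, 3}" "B \<in> {- 3, - 2, - 1, 0, 1, 2, 3}"
    using bound[of A] bound[of B] by auto
  then show ?thesis
    using Q N AB(2,3) by (auto simp: cong_def)
qed

theorem theorem1p2:
  fixes p r Q N :: nat
  assumes "prime p" and "odd p" and "r \<ge> 1"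
    and "Q = p ^ r"
    and "CARD('a::finite_field) = Q"
    and "N = nonsquare_triple_count TYPE('a)"
  shows "(Q \<le> 9 \<longrightarrow> N = 0) \<and>
    (Q > 9 \<longrightarrow>
       real N \<ge> 1 / 8 * (real Q - 2 * sqrt (real Q) - 3) \<and>
       (real N = 1 / 8 * (real Q - 2 * sqrt (real Q) - 3) \<longleftrightarrow>
          [p = 3] (mod 4) \<and> (\<exists>s. odd s \<and> r = 2 * s))) \<and>
    (N > 0 \<longleftrightarrow> Q > 9)"
proof -
  have card: "CARD('a) = p ^ r" using assms by simp
  have odd: "odd CARD('a)" using assms by simp
  have "r > 0" using assms by simp
  define R where "R = sqrt (real Q)"
  have R2: "R ^ 2 = real Q" and "R \<ge> 0" by (simp_all add: R_def)
  define E where "E \<longleftrightarrow> [p = 3] (mod 4) \<and> (\<exists>s. odd s \<and> r = 2 * s)"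
  have E_iff: "E \<longleftrightarrow> p mod 4 = 3 \<and> (\<exists>s. odd s \<and> r = 2 * s)"
    by (simp add: E_def cong_def)
  have small: "N = 0" if "Q \<le> 9"
    using nonsquare_triple_count_small[OF odd] assms that by simp
  have large: "R > 3" if "Q > 9"
    unfolding R_def using that by (intro real_less_rsqrt) simp
  have bound: "real Q - 2 * R - 3 \<le> 8 * real N \<and> (8 * real N = real Q - 2 * R - 3 \<longleftrightarrow> E)" if "Q > 9"
  proof (cases "Q mod 4 = 1")
    case False
    have "jacobsthal_sum (1::'a) = 0"
      using False assms by (intro jacobsthal_sum_eq_0[OF odd]) simp
    then have "8 * int N = int Q - 3 - (1 - quad_char (- 1 :: 'a)) * (1 - quad_char (- 2 :: 'a))"
      using nonsquare_triple_count_eq[OF odd] assms by simp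
    moreover have "(1 - quad_char (- 1 :: 'a)) * (1 - quad_char (- 2 :: 'a)) \<le> 4"
      using quad_char_values[of "- 1 :: 'a"] quad_char_values[of "- 2 :: 'a"] by auto
    ultimately have "8 * int N \<ge> int Q - 7"
      by simp
    then have "8 * real N \<ge> real Q - 7" by linarith
    then have "8 * real N > real Q - 2 * R - 3"
      using large[OF that] by linarith
    moreover have "\<not> E"
    proof
      assume E
      then obtain s where s: "r = 2 * s" "p mod 4 = 3"
        by (auto simp: E_iff)
      have "p ^ 2 mod 4 = 1"
        using power_mod[of p 4 2] s(2) by simp
      then have "(p ^ 2) ^ s mod 4 = 1"
        using power_mod[of "p ^ 2" 4 s] by simp
      then show False
        using False assms(4) s(1) by (simp add: power_mult)
    qed
    ultimately show ?thesis by simp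
  next
    case True
    then have mod: "CARD('a) mod 4 = 1" using assms by simp
    let ?S = "real_of_int (jacobsthal_sum (1::'a))"
    have "8 * int N = int Q - 3 - jacobsthal_sum (1::'a)"
      using nonsquare_triple_count_eq[OF odd] assms mod by (simp add: quad_char_minus_one[OF odd])
    then have N: "8 * real N = real Q - 3 - ?S" by linarith
    obtain A B where AB: "jacobsthal_sum (1::'a) = 2 * A" "A ^ 2 + B ^ 2 = int CARD('a)"
      using jacobsthal_sum_decomposition[OF mod] by metis
    have "A ^ 2 \<le> int Q"
      using AB(2) assms(5) zero_le_power2[of B] by linarith
    then have "real_of_int A ^ 2 \<le> real Q"
      by (metis of_int_le_iff of_int_of_nat_eq of_int_power)
    then have "real_of_int A \<le> R"
      unfolding R_def by (rule real_le_rsqrt)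
    then have "?S \<le> 2 * R"
      using AB(1) by simp
    moreover have "?S = 2 * R \<longleftrightarrow> E"
      using jacobsthal_sum_eq_extremal_iff[OF assms(1,2) card \<open>r > 0\<close> mod]
      by (simp add: E_iff R_def assms(5))
    ultimately show ?thesis
      using N by auto
  qed
  have pos: "real Q - 2 * R - 3 > 0" if "Q > 9"
  proof -
    have "(R - 3) * (R + 1) > 0"
      using large[OF that] by simp
    then show ?thesis using R2 by (simp add: algebra_simps power2_eq_square)
  qed
  have "N > 0 \<longleftrightarrow> Q > 9"
  proof
    assume "N > 0"
    then show "Q > 9" using small by (cases "Q > 9") auto
  next
    assume "Q > 9"
    then have "8 * real N > 0" using bound pos by force
    then show "N > 0" by simp
  qed
  moreover have "real N \<ge> 1 / 8 * (real Q - 2 * R - 3)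
      \<and> (real N = 1 / 8 * (real Q - 2 * R - 3) \<longleftrightarrow> E)" if "Q > 9"
    using bound[OF that] by auto
  ultimately show ?thesis
    using small unfolding R_def E_def by blast
qed

end
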